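(* Let $m_0\ge m_1\ge 1$, let $A_0=\sigma\sigma^*$ be a real symmetric positive semidefinite $m_0\times m_0$ matrix and $B_1$ a real $m_0\times m_1$ matrix of rank $m_1$, and let $(P_t)_{t\ge 0}$ be the semigroup on $\mathbb{R}^{m_0}\times\mathbb{R}^{m_1}$ of the diffusion $dX_1(t)=\sigma\,dB(t)$, $dX_2(t)=B_1^*X_1(t)\,dt$. Let $f\in C^2(\mathbb{R}^{m_0}\times\mathbb{R}^{m_1})$ have bounded second derivatives. Then for every $t\ge 0$, $x^{(1)}\in\mathbb{R}^{m_0}$, $x^{(2)}\in\mathbb{R}^{m_1}$ and every constant $\alpha_2\in\mathbb{R}$, $$\left\|\nabla^{(1)}P_tf(x^{(1)},x^{(2)})+\alpha_2B_1\nabla^{(2)}P_tf(x^{(1)},x^{(2)})\right\|_{A_0}^2\le P_t\left(\left\|\nabla^{(1)}f+(\alpha_2+t)B_1\nabla^{(2)}f\right\|_{A_0}^2\right)(x^{(1)},x^{(2)}).$$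
   Context: $M^*$ denotes the transpose of a matrix $M$. $\sigma$ is a constant $m_0\times m_0$ matrix with $\sigma\sigma^*=A_0$, and $B(t)$ is a standard Brownian motion in $\mathbb{R}^{m_0}$. The process started at $(x^{(1)},x^{(2)})$ is $\mathbf{X}_t=\left(x^{(1)}+\sigma B(t),\ x^{(2)}+tB_1^*x^{(1)}+\int_0^tB_1^*\sigma B(s)\,ds\right)$ with $B(0)=0$, and $P_tf(x^{(1)},x^{(2)})=\mathbb{E}[f(\mathbf{X}_t)]$ for this starting point. $\nabla^{(1)}f$ and $\nabla^{(2)}f$ are the (column) vectors of partial derivatives of $f$ with respect to the coordinates of $x^{(1)}\in\mathbb{R}^{m_0}$ and of $x^{(2)}\in\mathbb{R}^{m_1}$ respectively. For $v\in\mathbb{R}^{m_0}$, $\|v\|_{A_0}=\sqrt{v^*A_0v}$. *)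

theory Defs
  imports "HOL-Probability.Probability"
begin

text \<open>
  Standard Brownian motion in \<open>\<real>\<^sup>m\<close>, \<open>m = CARD('m)\<close>, started at the origin. The paths are required
  to be continuous surely, not just almost surely, so that their time integrals are measurable
  without completing the probability space. An increment over \<open>[s, t]\<close> has law \<open>N(0, (t - s) I)\<close>:
  its coordinates are independent, with density \<open>normal_density 0 (sqrt (t - s))\<close>
  (the second parameter of \<^const>\<open>normal_density\<close> is the standard deviation).
\<close>
definition standard_brownian_motion ::
    "'w measure \<Rightarrow> (real \<Rightarrow> 'w \<Rightarrow> real^'m) \<Rightarrow> bool" where
  "standard_brownian_motion M B \<longleftrightarrow>
     prob_space M \<and>
     (\<forall>t\<ge>0. B t \<in> borel_measurable M) \<and>
     (\<forall>\<omega>\<in>space M. B 0 \<omega> = 0) \<and>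
     (\<forall>\<omega>\<in>space M. continuous_on {0..} (\<lambda>t. B t \<omega>)) \<and>
     (\<forall>(\<tau> :: nat \<Rightarrow> real) n. 0 \<le> \<tau> 0 \<and> (\<forall>k<n. \<tau> k \<le> \<tau> (Suc k)) \<longrightarrow>
        prob_space.indep_vars M (\<lambda>_. borel)
          (\<lambda>k \<omega>. B (\<tau> (Suc k)) \<omega> - B (\<tau> k) \<omega>) {..<n}) \<and>
     (\<forall>s t. 0 \<le> s \<and> s < t \<longrightarrow>
        prob_space.indep_vars M (\<lambda>_. borel) (\<lambda>i \<omega>. (B t \<omega> - B s \<omega>) $ i) UNIV \<and>
        (\<forall>i. distributed M lborel (\<lambda>\<omega>. (B t \<omega> - B s \<omega>) $ i)
               (\<lambda>u. ennreal (normal_density 0 (sqrt (t - s)) u))))"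

definition diffusion ::
    "real^'m^'m \<Rightarrow> real^'n^'m \<Rightarrow> (real \<Rightarrow> 'w \<Rightarrow> real^'m) \<Rightarrow> real \<Rightarrow>
     (real^'m) \<times> (real^'n) \<Rightarrow> 'w \<Rightarrow> (real^'m) \<times> (real^'n)" where
  "diffusion \<sigma> B\<^sub>1 B t x \<omega> =
     (fst x + \<sigma> *v B t \<omega>,
      snd x + t *\<^sub>R (transpose B\<^sub>1 *v fst x)
        + integral {0..t} (\<lambda>s. transpose B\<^sub>1 *v (\<sigma> *v B s \<omega>)))"

definition semigroup_P ::
    "'w measure \<Rightarrow> real^'m^'m \<Rightarrow> real^'n^'m \<Rightarrow> (real \<Rightarrow> 'w \<Rightarrow> real^'m) \<Rightarrow> real \<Rightarrow>
     ((real^'m) \<times> (real^'n) \<Rightarrow> real) \<Rightarrow> (real^'m) \<times> (real^'n) \<Rightarrow> real" where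
  "semigroup_P M \<sigma> B\<^sub>1 B t f x = (\<integral>\<omega>. f (diffusion \<sigma> B\<^sub>1 B t x \<omega>) \<partial>M)"

definition grad1 :: "((real^'m) \<times> (real^'n) \<Rightarrow> real) \<Rightarrow> (real^'m) \<times> (real^'n) \<Rightarrow> real^'m" where
  "grad1 f x = (\<chi> i. deriv (\<lambda>h. f (fst x + h *\<^sub>R axis i 1, snd x)) 0)"

definition grad2 :: "((real^'m) \<times> (real^'n) \<Rightarrow> real) \<Rightarrow> (real^'m) \<times> (real^'n) \<Rightarrow> real^'n" where
  "grad2 f x = (\<chi> j. deriv (\<lambda>h. f (fst x, snd x + h *\<^sub>R axis j 1)) 0)"

definition mat_norm :: "real^'m^'m \<Rightarrow> real^'m \<Rightarrow> real" where
  "mat_norm A v = sqrt (v \<bullet> (A *v v))"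

text \<open>
  \<open>f \<in> C\<^sup>2\<close> with bounded second derivatives: \<open>f'\<close> and \<open>f''\<close> are the first and second Frechet
  derivatives, the latter as a map into the bounded linear operators; only \<open>f''\<close> is bounded.
\<close>
definition C2_bounded_second :: "('a::real_normed_vector \<Rightarrow> real) \<Rightarrow> bool" where
  "C2_bounded_second f \<longleftrightarrow>
     (\<exists>(f' :: 'a \<Rightarrow> 'a \<Rightarrow>\<^sub>L real) (f'' :: 'a \<Rightarrow> 'a \<Rightarrow>\<^sub>L 'a \<Rightarrow>\<^sub>L real).
        (\<forall>x. (f has_derivative blinfun_apply (f' x)) (at x)) \<and>
        (\<forall>x. (f' has_derivative blinfun_apply (f'' x)) (at x)) \<and>
        continuous_on UNIV f'' \<and> bounded (range f''))"

end

theory Submission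
  imports Defs
begin

text \<open>
  The diffusion depends affinely on its starting point: \<open>X\<^sub>t(x) = L x + X\<^sub>t(0)\<close>, where
  \<open>L (x\<^sub>1, x\<^sub>2) = (x\<^sub>1, x\<^sub>2 + t B\<^sub>1\<^sup>* x\<^sub>1)\<close> is the flow of the drift and only \<open>X\<^sub>t(0)\<close> is random.
  Hence \<open>D(P\<^sub>t f)(x) h = E[Df(X\<^sub>t(x)) (L h)]\<close>. Pairing \<open>\<nabla>\<^sup>1 F + \<beta> B\<^sub>1 \<nabla>\<^sup>2 F\<close> with a vector \<open>v\<close> is the
  same as differentiating \<open>F\<close> in the direction \<open>(v, \<beta> B\<^sub>1\<^sup>* v)\<close>, and \<open>L\<close> sends the direction with
  \<open>\<beta> = \<alpha>\<^sub>2\<close> to the one with \<open>\<beta> = \<alpha>\<^sub>2 + t\<close>. This proves the exact commutation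
  \<open>\<nabla>\<^sup>1 P\<^sub>t f + \<alpha>\<^sub>2 B\<^sub>1 \<nabla>\<^sup>2 P\<^sub>t f = P\<^sub>t (\<nabla>\<^sup>1 f + (\<alpha>\<^sub>2 + t) B\<^sub>1 \<nabla>\<^sup>2 f)\<close>. Since \<open>\<parallel>g\<parallel>\<^sup>2 = \<Sum>\<^sub>i (\<sigma>\<^sub>i \<bullet> g)\<^sup>2\<close> over
  the columns \<open>\<sigma>\<^sub>i\<close> of \<open>\<sigma>\<close>, the inequality follows from \<open>(E Z)\<^sup>2 \<le> E Z\<^sup>2\<close> applied to each column.

  The analytic content is the differentiation under the expectation
  (\<open>has_derivative_expectation_affine\<close>) and the integrability of all terms. As the second derivative is
  bounded, \<open>f'\<close> is Lipschitz:
  the first-order Taylor remainder of \<open>f\<close> is at most \<open>C \<parallel>k\<parallel>\<^sup>2\<close> with \<open>C\<close> independent of the base point,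
  hence of the path, so taking expectations in the Taylor expansion is enough. The same Lipschitz
  bound makes \<open>f\<close> grow at most quadratically and \<open>f'\<close> at most linearly, so everything is integrable
  once \<open>X\<^sub>t(0)\<close> has a second moment (\<open>diffusion_square_integrable\<close>). For the time integral
  of \<open>B\<close>, both measurability and the second moment are obtained by passing to the limit in
  left Riemann sums.
\<close>

section \<open>Functions with a Lipschitz derivative\<close>

lemma C2_bounded_second_lipschitz_derivative:
  fixes f :: "'a::real_normed_vector \<Rightarrow> real"
  assumes "C2_bounded_second f"
  obtains f' C where "\<And>x. (f has_derivative blinfun_apply (f' x)) (at x)"
    and "C-lipschitz_on UNIV f'"
proof -
  obtain f' f'' where f': "\<forall>x. (f has_derivative blinfun_apply (f' x)) (at x)"
    and f'': "\<forall>x. (f' has_derivative blinfun_apply (f'' x)) (at x)"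
    and bdd: "bounded (range f'')"
    using assms unfolding C2_bounded_second_def by auto
  obtain C where C: "\<And>x. norm (f'' x) \<le> C"
    using bdd unfolding bounded_iff by auto
  have "0 \<le> C" using order_trans[OF norm_ge_zero C] .
  have "norm (f' x - f' y) \<le> C * norm (x - y)" for x y
  proof (rule differentiable_bound[where S = UNIV])
    show "(f' has_derivative blinfun_apply (f'' x)) (at x within UNIV)" for x
      using f'' by simp
    show "onorm (blinfun_apply (f'' x)) \<le> C" for x
      using C[of x] by (simp add: norm_blinfun.rep_eq)
  qed simp_all
  then have "C-lipschitz_on UNIV f'"
    using \<open>0 \<le> C\<close> by (intro lipschitz_onI) (simp_all add: dist_norm)
  with f' that show ?thesis by blast
qed

text \<open>
  Uniformity in \<open>y\<close> is what permits substituting a random base point and integrating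
  the bound without a dominating function.
\<close>
lemma lipschitz_derivative_remainder:
  fixes f :: "'a::real_normed_vector \<Rightarrow> real"
  assumes f': "\<And>x. (f has_derivative blinfun_apply (f' x)) (at x)"
    and lip: "C-lipschitz_on UNIV f'"
  shows "\<bar>f (y + k) - f y - f' y k\<bar> \<le> C * (norm k)\<^sup>2"
proof -
  have "norm (f (y + k) - f y - f' y (y + k - y)) \<le> norm (y + k - y) * (C * norm k)"
  proof (rule differentiable_bound_linearization[where S = "cball y (norm k)"])
    show "(f has_derivative blinfun_apply (f' x)) (at x within cball y (norm k))" for x
      using f' by (rule has_derivative_at_withinI)
    show "onorm (blinfun_apply (f' x) - blinfun_apply (f' y)) \<le> C * norm k"
      if "x \<in> cball y (norm k)" for x
    proof -
      have "onorm (blinfun_apply (f' x) - blinfun_apply (f' y)) = dist (f' x) (f' y)"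
        by (simp add: dist_norm norm_blinfun.rep_eq minus_blinfun.rep_eq fun_diff_def)
      also have "\<dots> \<le> C * dist x y"
        using lipschitz_onD[OF lip] by simp
      also have "\<dots> \<le> C * norm k"
        using that lipschitz_on_nonneg[OF lip] by (auto intro!: mult_left_mono simp: dist_commute)
      finally show ?thesis .
    qed
  qed (auto simp: dist_norm mult_left_le_one_le)
  then show ?thesis
    by (simp add: power2_eq_square algebra_simps)
qed

lemma lipschitz_derivative_linear_growth:
  fixes f' :: "'a::real_normed_vector \<Rightarrow> 'a \<Rightarrow>\<^sub>L real"
  assumes "C-lipschitz_on UNIV f'"
  shows "norm (f' y) \<le> norm (f' 0) + C * norm y"
  using lipschitz_onD[OF assms, of y 0] norm_triangle_ineq2[of "f' y" "f' 0"]
  by (simp add: dist_norm)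

section \<open>Differentiating an expectation in the starting point\<close>

lemma (in prob_space) integrable_norm_of_square_integrable:
  fixes X :: "'a \<Rightarrow> 'b::euclidean_space"
  assumes [measurable]: "X \<in> borel_measurable M"
    and "integrable M (\<lambda>\<omega>. (norm (X \<omega>))\<^sup>2)"
  shows "integrable M (\<lambda>\<omega>. norm (X \<omega>))"
proof (rule Bochner_Integration.integrable_bound)
  show "integrable M (\<lambda>\<omega>. 1 + (norm (X \<omega>))\<^sup>2)"
    using assms(2) by simp
  \<comment> \<open>complete the square: \<open>r \<le> r\<^sup>2 + 1 / 4\<close>\<close>
  have "r \<le> 1 + r\<^sup>2" for r :: real
    using zero_le_power2[of "r - 1 / 2"] by (simp add: power2_eq_square algebra_simps)
  then show "AE \<omega> in M. norm (norm (X \<omega>)) \<le> norm (1 + (norm (X \<omega>))\<^sup>2)"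
    by simp
qed simp

lemma (in prob_space) integrable_translate_square:
  fixes X :: "'a \<Rightarrow> 'b::euclidean_space"
  assumes [measurable]: "X \<in> borel_measurable M"
    and "integrable M (\<lambda>\<omega>. (norm (X \<omega>))\<^sup>2)"
  shows "integrable M (\<lambda>\<omega>. (norm (c + X \<omega>))\<^sup>2)"
proof (rule Bochner_Integration.integrable_bound)
  show "integrable M (\<lambda>\<omega>. 2 * (norm c)\<^sup>2 + 2 * (norm (X \<omega>))\<^sup>2)"
    using assms(2) by simp
  have "(norm (c + x))\<^sup>2 \<le> 2 * (norm c)\<^sup>2 + 2 * (norm x)\<^sup>2" for x
    using power_mono[OF norm_triangle_ineq[of c x], of 2] sum_squares_bound[of "norm c" "norm x"]
    by (simp add: power2_sum)
  then show "AE \<omega> in M. norm ((norm (c + X \<omega>))\<^sup>2) \<le> norm (2 * (norm c)\<^sup>2 + 2 * (norm (X \<omega>))\<^sup>2)"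
    by simp
qed simp

text \<open>
  A function with Lipschitz derivative is \<open>O(1 + \<parallel>y\<parallel>\<^sup>2)\<close>, as is the square of its derivative, so a
  second moment of the argument suffices.
\<close>
lemma (in prob_space) integrable_lipschitz_derivative:
  fixes f :: "'b::euclidean_space \<Rightarrow> real"
  assumes f': "\<And>x. (f has_derivative blinfun_apply (f' x)) (at x)"
    and lip: "C-lipschitz_on UNIV f'"
    and X[measurable]: "X \<in> borel_measurable M"
    and X2: "integrable M (\<lambda>\<omega>. (norm (X \<omega>))\<^sup>2)"
  shows "integrable M (\<lambda>\<omega>. f (X \<omega>))"
    and "integrable M (\<lambda>\<omega>. f' (X \<omega>) h)"
    and "integrable M (\<lambda>\<omega>. (f' (X \<omega>) h)\<^sup>2)"
proof -
  have "continuous_on UNIV f"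
    using f' by (auto intro!: has_derivative_continuous_on)
  then have f_meas[measurable]: "f \<in> borel_measurable borel"
    by (rule borel_measurable_continuous_onI)
  have "continuous_on UNIV (\<lambda>x. f' x h)"
    using lipschitz_on_continuous_on[OF lip] by (intro continuous_intros)
  then have f'_meas[measurable]: "(\<lambda>x. f' x h) \<in> borel_measurable borel"
    by (rule borel_measurable_continuous_onI)
  have X1: "integrable M (\<lambda>\<omega>. norm (X \<omega>))"
    using X X2 by (rule integrable_norm_of_square_integrable)
  have "0 \<le> C" using lip by (rule lipschitz_on_nonneg)
  have bound: "\<bar>f' y h\<bar> \<le> norm h * norm (f' 0) + norm h * C * norm y" for y
  proof -
    have "\<bar>f' y h\<bar> \<le> norm (f' y) * norm h"
      using norm_blinfun[of "f' y" h] by simp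
    also have "\<dots> \<le> (norm (f' 0) + C * norm y) * norm h"
      by (intro mult_right_mono lipschitz_derivative_linear_growth[OF lip]) simp
    finally show ?thesis by (simp add: algebra_simps)
  qed
  show "integrable M (\<lambda>\<omega>. f (X \<omega>))"
  proof (rule Bochner_Integration.integrable_bound)
    show "integrable M (\<lambda>\<omega>. \<bar>f 0\<bar> + norm (f' 0) * norm (X \<omega>) + C * (norm (X \<omega>))\<^sup>2)"
      using X1 X2 by simp
    have "\<bar>f y\<bar> \<le> \<bar>f 0\<bar> + norm (f' 0) * norm y + C * (norm y)\<^sup>2" for y
      using lipschitz_derivative_remainder[OF f' lip, of 0 y] norm_blinfun[of "f' 0" y]
      by simp
    then show "AE \<omega> in M. norm (f (X \<omega>))
        \<le> norm (\<bar>f 0\<bar> + norm (f' 0) * norm (X \<omega>) + C * (norm (X \<omega>))\<^sup>2)"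
      using \<open>0 \<le> C\<close> by simp
  qed simp
  show "integrable M (\<lambda>\<omega>. f' (X \<omega>) h)"
  proof (rule Bochner_Integration.integrable_bound)
    show "integrable M (\<lambda>\<omega>. norm h * norm (f' 0) + norm h * C * norm (X \<omega>))"
      using X1 by simp
  qed (use bound \<open>0 \<le> C\<close> in simp_all)
  show "integrable M (\<lambda>\<omega>. (f' (X \<omega>) h)\<^sup>2)"
  proof (rule Bochner_Integration.integrable_bound)
    show "integrable M (\<lambda>\<omega>. (norm h * norm (f' 0) + norm h * C * norm (X \<omega>))\<^sup>2)"
      using X1 X2 by (simp add: power2_sum power_mult_distrib)
    show "AE \<omega> in M. norm ((f' (X \<omega>) h)\<^sup>2)
        \<le> norm ((norm h * norm (f' 0) + norm h * C * norm (X \<omega>))\<^sup>2)"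
      using power_mono[OF bound, where n = 2] by simp
  qed simp
qed

text \<open>
  The remainder of the expectation at \<open>x\<close> in direction \<open>h\<close> is the expectation of the remainder of \<open>f\<close>
  at the random point \<open>L x + X\<close> in the deterministic direction \<open>L h\<close>; it is bounded by
  \<open>C \<parallel>L h\<parallel>\<^sup>2\<close>, which is \<open>o(\<parallel>h\<parallel>)\<close>.
\<close>
lemma (in prob_space) has_derivative_expectation_affine:
  fixes f :: "'b::euclidean_space \<Rightarrow> real" and L :: "'c::euclidean_space \<Rightarrow> 'b"
  assumes f': "\<And>x. (f has_derivative blinfun_apply (f' x)) (at x)"
    and lip: "C-lipschitz_on UNIV f'"
    and X[measurable]: "X \<in> borel_measurable M"
    and X2: "integrable M (\<lambda>\<omega>. (norm (X \<omega>))\<^sup>2)"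
    and L: "linear L"
  shows "((\<lambda>x. expectation (\<lambda>\<omega>. f (L x + X \<omega>))) has_derivative
    (\<lambda>h. expectation (\<lambda>\<omega>. f' (L x + X \<omega>) (L h)))) (at x)"
proof -
  define D where "D h = expectation (\<lambda>\<omega>. f' (L x + X \<omega>) (L h))" for h
  have meas: "(\<lambda>\<omega>. L z + X \<omega>) \<in> borel_measurable M" for z
    by simp
  note int = integrable_lipschitz_derivative[OF f' lip meas integrable_translate_square[OF X X2]]
  have "linear D"
    unfolding D_def
    by (rule linearI) (simp_all add: linear_add[OF L] linear_scale[OF L] blinfun.add_right
        blinfun.scaleR_right int)
  obtain K where K: "\<And>h. norm (L h) \<le> K * norm h"
    using linear_bounded[OF L] by blast
  have "0 \<le> C" using lip by (rule lipschitz_on_nonneg)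
  have "((\<lambda>x. expectation (\<lambda>\<omega>. f (L x + X \<omega>))) has_derivative D) (at x)"
  proof (rule has_derivativeI_sandwich[where e = 1 and H = "\<lambda>y. C * K\<^sup>2 * norm (y - x)"])
    show "bounded_linear D"
      using \<open>linear D\<close> by (simp add: linear_conv_bounded_linear)
    show "((\<lambda>y. C * K\<^sup>2 * norm (y - x)) \<longlongrightarrow> 0) (at x)"
      by (auto intro!: tendsto_eq_intros)
    fix y assume "y \<noteq> x"
    define h where "h = y - x"
    have Ly: "L y = L x + L h"
      by (simp add: h_def linear_diff[OF L])
    have "\<bar>expectation (\<lambda>\<omega>. f (L y + X \<omega>)) - expectation (\<lambda>\<omega>. f (L x + X \<omega>)) - D h\<bar>
      = \<bar>expectation (\<lambda>\<omega>. f (L y + X \<omega>) - f (L x + X \<omega>) - f' (L x + X \<omega>) (L h))\<bar>"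
      unfolding D_def by (simp add: int)
    also have "\<dots> \<le> expectation (\<lambda>\<omega>. C * (norm (L h))\<^sup>2)"
    proof (rule order_trans[OF integral_abs_bound integral_mono])
      show "\<bar>f (L y + X \<omega>) - f (L x + X \<omega>) - f' (L x + X \<omega>) (L h)\<bar> \<le> C * (norm (L h))\<^sup>2" for \<omega>
        using lipschitz_derivative_remainder[OF f' lip, of "L x + X \<omega>" "L h"]
        by (simp add: Ly add_ac)
    qed (simp_all add: int)
    also have "\<dots> = C * (norm (L h))\<^sup>2"
      by (simp add: prob_space)
    also have "\<dots> \<le> C * (K * norm h)\<^sup>2"
      using \<open>0 \<le> C\<close> K[of h] by (intro mult_left_mono power_mono) simp_all
    finally show "norm (expectation (\<lambda>\<omega>. f (L y + X \<omega>)) - expectation (\<lambda>\<omega>. f (L x + X \<omega>))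
        - D (y - x)) / norm (y - x) \<le> C * K\<^sup>2 * norm (y - x)"
      using \<open>y \<noteq> x\<close> unfolding h_def[symmetric]
      by (simp add: h_def divide_le_eq power2_eq_square algebra_simps)
  qed simp
  then show ?thesis unfolding D_def .
qed

lemma (in prob_space) expectation_square_le:
  fixes Z :: "'a \<Rightarrow> real"
  assumes "integrable M Z" and "integrable M (\<lambda>\<omega>. (Z \<omega>)\<^sup>2)"
  shows "(expectation Z)\<^sup>2 \<le> expectation (\<lambda>\<omega>. (Z \<omega>)\<^sup>2)"
  using variance_eq[OF assms] variance_positive[of Z] by simp

section \<open>The twisted gradient\<close>

lemma inner_grad1:
  fixes F :: "(real^'m) \<times> (real^'n) \<Rightarrow> real"
  assumes D: "(F has_derivative D) (at x)"
  shows "v \<bullet> grad1 F x = D (v, 0)"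
proof -
  interpret D: bounded_linear D using D by (rule has_derivative_bounded_linear)
  have "grad1 F x $ i = D (axis i 1, 0)" for i
  proof -
    have "((\<lambda>h. (fst x + h *\<^sub>R axis i 1, snd x)) has_derivative (\<lambda>h. (h *\<^sub>R axis i 1, 0))) (at (0::real))"
      by (auto intro!: derivative_eq_intros)
    moreover have "(F has_derivative D) (at (fst x + (0::real) *\<^sub>R axis i 1, snd x))"
      using D by simp
    ultimately have "((\<lambda>h. F (fst x + h *\<^sub>R axis i 1, snd x)) has_derivative
        (\<lambda>h. D (h *\<^sub>R axis i 1, 0))) (at 0)"
      by (rule has_derivative_compose)
    moreover have "D (h *\<^sub>R axis i 1, 0) = D (axis i 1, 0) * h" for h
      using D.scaleR[of h "(axis i 1, 0)"] by simp
    ultimately show ?thesis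
      unfolding grad1_def by (simp add: has_field_derivative_def DERIV_imp_deriv)
  qed
  then have "v \<bullet> grad1 F x = (\<Sum>i\<in>UNIV. D (v $ i *\<^sub>R (axis i 1, 0)))"
    by (simp add: inner_vec_def D.scaleR del: scaleR_Pair)
  also have "\<dots> = D (\<Sum>i\<in>UNIV. v $ i *\<^sub>R (axis i 1, 0))"
    by (simp only: D.sum)
  also have "(\<Sum>i\<in>UNIV. v $ i *\<^sub>R (axis i 1, 0 :: real^'n)) = (v, 0)"
    by (simp add: prod_eq_iff fst_sum snd_sum basis_expansion scalar_mult_eq_scaleR[symmetric])
  finally show ?thesis .
qed

lemma inner_grad2:
  fixes F :: "(real^'m) \<times> (real^'n) \<Rightarrow> real"
  assumes D: "(F has_derivative D) (at x)"
  shows "w \<bullet> grad2 F x = D (0, w)"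
proof -
  interpret D: bounded_linear D using D by (rule has_derivative_bounded_linear)
  have "grad2 F x $ i = D (0, axis i 1)" for i
  proof -
    have "((\<lambda>h. (fst x, snd x + h *\<^sub>R axis i 1)) has_derivative (\<lambda>h. (0, h *\<^sub>R axis i 1))) (at (0::real))"
      by (auto intro!: derivative_eq_intros)
    moreover have "(F has_derivative D) (at (fst x, snd x + (0::real) *\<^sub>R axis i 1))"
      using D by simp
    ultimately have "((\<lambda>h. F (fst x, snd x + h *\<^sub>R axis i 1)) has_derivative
        (\<lambda>h. D (0, h *\<^sub>R axis i 1))) (at 0)"
      by (rule has_derivative_compose)
    moreover have "D (0, h *\<^sub>R axis i 1) = D (0, axis i 1) * h" for h
      using D.scaleR[of h "(0, axis i 1)"] by simp
    ultimately show ?thesis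
      unfolding grad2_def by (simp add: has_field_derivative_def DERIV_imp_deriv)
  qed
  then have "w \<bullet> grad2 F x = (\<Sum>i\<in>UNIV. D (w $ i *\<^sub>R (0, axis i 1)))"
    by (simp add: inner_vec_def D.scaleR del: scaleR_Pair)
  also have "\<dots> = D (\<Sum>i\<in>UNIV. w $ i *\<^sub>R (0, axis i 1))"
    by (simp only: D.sum)
  also have "(\<Sum>i\<in>UNIV. w $ i *\<^sub>R (0 :: real^'m, axis i 1)) = (0, w)"
    by (simp add: prod_eq_iff fst_sum snd_sum basis_expansion scalar_mult_eq_scaleR[symmetric])
  finally show ?thesis .
qed

text \<open>
  The combination of gradients in the theorem is thus itself a directional derivative, which can be
  transported through linear changes of variable.
\<close>
lemma inner_twisted_gradient:
  fixes F :: "(real^'m) \<times> (real^'n) \<Rightarrow> real" and B\<^sub>1 :: "real^'n^'m"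
  assumes D: "(F has_derivative D) (at x)"
  shows "v \<bullet> (grad1 F x + \<beta> *\<^sub>R (B\<^sub>1 *v grad2 F x)) = D (v, \<beta> *\<^sub>R (transpose B\<^sub>1 *v v))"
proof -
  interpret D: bounded_linear D using D by (rule has_derivative_bounded_linear)
  have "v \<bullet> (B\<^sub>1 *v grad2 F x) = (transpose B\<^sub>1 *v v) \<bullet> grad2 F x"
    by (simp add: dot_lmul_matrix[symmetric])
  then have "v \<bullet> (grad1 F x + \<beta> *\<^sub>R (B\<^sub>1 *v grad2 F x))
      = D (v, 0) + \<beta> *\<^sub>R D (0, transpose B\<^sub>1 *v v)"
    by (simp add: inner_add_right inner_grad1[OF D] inner_grad2[OF D])
  also have "\<dots> = D ((v, 0) + \<beta> *\<^sub>R (0, transpose B\<^sub>1 *v v))"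
    by (simp only: D.add D.scaleR)
  finally show ?thesis by simp
qed

text \<open>
  The factorisation \<open>A\<^sub>0 = \<sigma> \<sigma>\<^sup>*\<close> turns the seminorm into a sum of squares of scalars, so that the
  scalar Jensen inequality applies term by term.
\<close>
lemma mat_norm_square_eq_sum_columns:
  fixes \<sigma> :: "real^'m^'m"
  shows "(mat_norm (\<sigma> ** transpose \<sigma>) g)\<^sup>2 = (\<Sum>i\<in>UNIV. (column i \<sigma> \<bullet> g)\<^sup>2)"
proof -
  have "g \<bullet> ((\<sigma> ** transpose \<sigma>) *v g) = (g v* \<sigma>) \<bullet> (g v* \<sigma>)"
    by (simp add: matrix_vector_mul_assoc[symmetric] dot_lmul_matrix[symmetric])
  moreover have "(g v* \<sigma>) $ i = column i \<sigma> \<bullet> g" for i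
    by (simp add: vector_matrix_mult_def column_def inner_vec_def mult.commute)
  ultimately show ?thesis
    unfolding mat_norm_def
    by (simp add: inner_vec_def[of "g v* \<sigma>"] power2_eq_square sum_nonneg)
qed

section \<open>Second moments of the diffusion\<close>

text \<open>
  The upper limit is written as \<open>n h\<close> so that the estimate can be proved by adding one cell of
  length \<open>h\<close> at a time.
\<close>
lemma integral_minus_left_sum_le:
  fixes g :: "real \<Rightarrow> 'b::euclidean_space"
  assumes "0 \<le> h" and cont: "continuous_on {0..real n * h} g"
    and osc: "\<And>u v. \<lbrakk>u \<in> {0..real n * h}; v \<in> {0..real n * h}; \<bar>u - v\<bar> \<le> h\<rbrakk>
      \<Longrightarrow> norm (g u - g v) \<le> e"
  shows "norm (integral {0..real n * h} g - (\<Sum>k<n. h *\<^sub>R g (real k * h))) \<le> real n * h * e"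
  using cont osc
proof (induction n)
  case 0
  then show ?case by simp
next
  case (Suc n)
  have le: "real n * h \<le> real (Suc n) * h" and nn: "0 \<le> real n * h"
    using \<open>0 \<le> h\<close> by (auto intro: mult_right_mono)
  have g_int: "g integrable_on {0..real (Suc n) * h}"
    using Suc.prems(1) by (rule integrable_continuous_real)
  have sub: "{0..real n * h} \<subseteq> {0..real (Suc n) * h}" using le by auto
  have IH: "norm (integral {0..real n * h} g - (\<Sum>k<n. h *\<^sub>R g (real k * h))) \<le> real n * h * e"
    using sub by (intro Suc.IH continuous_on_subset[OF Suc.prems(1)] Suc.prems(2)) auto
  have last: "norm (integral {real n * h..real (Suc n) * h} g - h *\<^sub>R g (real n * h)) \<le> h * e"
  proof -
    have gi: "g integrable_on {real n * h..real (Suc n) * h}"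
      using nn by (intro integrable_continuous_real continuous_on_subset[OF Suc.prems(1)]) auto
    have "integral {real n * h..real (Suc n) * h} g - h *\<^sub>R g (real n * h)
        = integral {real n * h..real (Suc n) * h} (\<lambda>s. g s - g (real n * h))"
      using integral_diff[OF gi integrable_const_ivl, of "g (real n * h)"] le
      by (simp add: algebra_simps)
    also have "norm \<dots> \<le> e * (real (Suc n) * h - real n * h)"
    proof (rule integral_bound)
      show "continuous_on {real n * h..real (Suc n) * h} (\<lambda>s. g s - g (real n * h))"
        using nn by (intro continuous_intros continuous_on_subset[OF Suc.prems(1)]) auto
      show "norm (g s - g (real n * h)) \<le> e" if "s \<in> {real n * h..real (Suc n) * h}" for s
        using that nn le order_trans[OF nn, of s] by (intro Suc.prems(2)) (simp_all add: algebra_simps)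
    qed (rule le)
    finally show ?thesis by (simp add: algebra_simps)
  qed
  have "integral {0..real (Suc n) * h} g
      = integral {0..real n * h} g + integral {real n * h..real (Suc n) * h} g"
    using Henstock_Kurzweil_Integration.integral_combine[OF nn le g_int] by simp
  then have "integral {0..real (Suc n) * h} g - (\<Sum>k<Suc n. h *\<^sub>R g (real k * h))
      = (integral {0..real n * h} g - (\<Sum>k<n. h *\<^sub>R g (real k * h)))
      + (integral {real n * h..real (Suc n) * h} g - h *\<^sub>R g (real n * h))"
    by simp
  also have "norm \<dots> \<le> real n * h * e + h * e"
    by (rule norm_triangle_mono[OF IH last])
  finally show ?case by (simp add: algebra_simps)
qed

lemma left_sums_tendsto_integral:
  fixes g :: "real \<Rightarrow> 'b::euclidean_space"
  assumes "0 \<le> t" and cont: "continuous_on {0..t} g"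
  shows "(\<lambda>n. \<Sum>k<Suc n. (t / Suc n) *\<^sub>R g (real k * (t / Suc n))) \<longlonglongrightarrow> integral {0..t} g"
proof (rule LIMSEQ_I)
  fix r :: real assume "0 < r"
  \<comment> \<open>\<open>t + 1\<close> rather than \<open>t\<close>: it makes \<open>t * e\<close> strictly below \<open>r\<close> and covers \<open>t = 0\<close>\<close>
  define e where "e = r / (t + 1)"
  have "0 < e" using \<open>0 < r\<close> \<open>0 \<le> t\<close> by (simp add: e_def)
  have "uniformly_continuous_on {0..t} g"
    using cont by (rule compact_uniformly_continuous) simp
  then obtain d where "0 < d" and d: "\<And>u v. \<lbrakk>u \<in> {0..t}; v \<in> {0..t}; \<bar>u - v\<bar> < d\<rbrakk>
      \<Longrightarrow> norm (g u - g v) < e"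
    using \<open>0 < e\<close> unfolding uniformly_continuous_on_def dist_norm real_norm_def by meson
  obtain N :: nat where N: "t / d < real N" using reals_Archimedean2 by blast
  show "\<exists>no. \<forall>n\<ge>no. norm ((\<Sum>k<Suc n. (t / Suc n) *\<^sub>R g (real k * (t / Suc n))) - integral {0..t} g) < r"
  proof (intro exI allI impI)
    fix n assume "N \<le> n"
    define h where "h = t / real (Suc n)"
    have "0 \<le> h" using \<open>0 \<le> t\<close> by (simp add: h_def)
    have t: "real (Suc n) * h = t" by (simp add: h_def)
    have "t < d * real N" using N \<open>0 < d\<close> by (simp add: field_simps)
    also have "\<dots> \<le> d * real (Suc n)" using \<open>0 < d\<close> \<open>N \<le> n\<close> by simp
    finally have "h < d" by (simp add: h_def divide_less_eq)
    have "norm (integral {0..real (Suc n) * h} g - (\<Sum>k<Suc n. h *\<^sub>R g (real k * h)))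
        \<le> real (Suc n) * h * e"
    proof (rule integral_minus_left_sum_le[OF \<open>0 \<le> h\<close>])
      show "norm (g u - g v) \<le> e"
        if "u \<in> {0..real (Suc n) * h}" "v \<in> {0..real (Suc n) * h}" "\<bar>u - v\<bar> \<le> h" for u v
        using d[of u v] that \<open>h < d\<close> unfolding t by simp
    qed (use cont t in simp)
    also have "\<dots> = r * (t / (t + 1))" unfolding t by (simp add: e_def)
    also have "\<dots> < r * 1"
      using \<open>0 < r\<close> \<open>0 \<le> t\<close> by (intro mult_strict_left_mono) simp_all
    finally show "norm ((\<Sum>k<Suc n. (t / Suc n) *\<^sub>R g (real k * (t / Suc n))) - integral {0..t} g) < r"
      unfolding t by (simp only: h_def norm_minus_commute mult_1_right)
  qed
qed

text \<open>Fatou's lemma, in the form in which it gives integrability of a pointwise limit.\<close>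
lemma integrable_limit_of_bounded_integrals:
  fixes u :: "nat \<Rightarrow> 'a \<Rightarrow> real"
  assumes int: "\<And>n. integrable M (u n)" and nonneg: "\<And>n \<omega>. 0 \<le> u n \<omega>"
    and bound: "\<And>n. integral\<^sup>L M (u n) \<le> C"
    and lim: "\<And>\<omega>. \<omega> \<in> space M \<Longrightarrow> (\<lambda>n. u n \<omega>) \<longlonglongrightarrow> v \<omega>"
  shows "integrable M v"
proof (rule integrableI_bounded)
  have [measurable]: "u n \<in> borel_measurable M" for n
    using int by (rule borel_measurable_integrable)
  show "v \<in> borel_measurable M"
    using lim by (rule borel_measurable_LIMSEQ_metric[rotated]) measurable
  have v_nonneg: "0 \<le> v \<omega>" if "\<omega> \<in> space M" for \<omega>
    using LIMSEQ_le_const[OF lim[OF that]] nonneg by blast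
  have "(\<integral>\<^sup>+\<omega>. ennreal (norm (v \<omega>)) \<partial>M) = (\<integral>\<^sup>+\<omega>. liminf (\<lambda>n. ennreal (u n \<omega>)) \<partial>M)"
  proof (rule nn_integral_cong)
    fix \<omega> assume "\<omega> \<in> space M"
    then have "(\<lambda>n. ennreal (u n \<omega>)) \<longlonglongrightarrow> ennreal (v \<omega>)"
      by (intro tendsto_ennrealI lim)
    then have "liminf (\<lambda>n. ennreal (u n \<omega>)) = ennreal (v \<omega>)"
      by (intro lim_imp_Liminf) simp_all
    then show "ennreal (norm (v \<omega>)) = liminf (\<lambda>n. ennreal (u n \<omega>))"
      using v_nonneg[OF \<open>\<omega> \<in> space M\<close>] by simp
  qed
  also have "\<dots> \<le> liminf (\<lambda>n. \<integral>\<^sup>+\<omega>. ennreal (u n \<omega>) \<partial>M)"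
    by (rule nn_integral_liminf) simp
  also have "\<dots> \<le> liminf (\<lambda>n::nat. ennreal C)"
    using int nonneg bound
    by (intro Liminf_mono always_eventually allI) (simp add: nn_integral_eq_integral ennreal_leI)
  also have "\<dots> < \<infinity>" by (simp add: Liminf_const)
  finally show "(\<integral>\<^sup>+\<omega>. ennreal (norm (v \<omega>)) \<partial>M) < \<infinity>" .
qed

text \<open>
  As \<open>B\<close> starts at the origin, \<open>B s\<close> is the increment over \<open>[0, s]\<close>, whose coordinates are
  normal with variance \<open>s\<close>.
\<close>
lemma brownian_motion_second_moment:
  fixes B :: "real \<Rightarrow> 'w \<Rightarrow> real^'m"
  assumes bm: "standard_brownian_motion M B" and "0 \<le> s"
  shows "integrable M (\<lambda>\<omega>. (norm (B s \<omega>))\<^sup>2)"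
    and "(\<integral>\<omega>. (norm (B s \<omega>))\<^sup>2 \<partial>M) = real CARD('m) * s"
proof -
  interpret prob_space M using bm by (simp add: standard_brownian_motion_def)
  have B0: "B 0 \<omega> = 0" if "\<omega> \<in> space M" for \<omega>
    using bm that by (simp add: standard_brownian_motion_def)
  \<comment> \<open>for \<open>s = 0\<close> the law of the increment is not given by a density\<close>
  have comp: "integrable M (\<lambda>\<omega>. (B s \<omega> $ i)\<^sup>2) \<and> (\<integral>\<omega>. (B s \<omega> $ i)\<^sup>2 \<partial>M) = s" for i
  proof (cases "s = 0")
    case True
    then show ?thesis
      using B0 by (simp cong: Bochner_Integration.integrable_cong Bochner_Integration.integral_cong)
  next
    case False
    with \<open>0 \<le> s\<close> have "0 < s" by simp
    have dist: "distributed M lborel (\<lambda>\<omega>. (B s \<omega> - B 0 \<omega>) $ i)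
        (\<lambda>u. ennreal (normal_density 0 (sqrt s) u))"
      using bm \<open>0 < s\<close> unfolding standard_brownian_motion_def by fastforce
    have sq: "(\<lambda>u::real. u\<^sup>2) \<in> borel_measurable lborel" by simp
    have "integrable M (\<lambda>\<omega>. ((B s \<omega> - B 0 \<omega>) $ i)\<^sup>2)"
    proof -
      have "integrable lborel (\<lambda>u. normal_density 0 (sqrt s) u * u\<^sup>2)"
        using integrable_normal_moment[of "sqrt s" 0 2] \<open>0 < s\<close> by simp
      then show ?thesis
        using distributed_integrable[OF dist sq] by simp
    qed
    moreover have "(\<integral>\<omega>. ((B s \<omega> - B 0 \<omega>) $ i)\<^sup>2 \<partial>M) = s"
      using distributed_integral[OF dist sq] integral_normal_moment_even[of "sqrt s" 0 1] \<open>0 < s\<close>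
      by (simp add: fact_numeral)
    ultimately show ?thesis
      using B0 by (simp cong: Bochner_Integration.integrable_cong Bochner_Integration.integral_cong)
  qed
  have norm_sq: "(norm (B s \<omega>))\<^sup>2 = (\<Sum>i\<in>UNIV. (B s \<omega> $ i)\<^sup>2)" for \<omega>
    unfolding power2_norm_eq_inner by (simp add: inner_vec_def power2_eq_square)
  show "integrable M (\<lambda>\<omega>. (norm (B s \<omega>))\<^sup>2)"
    unfolding norm_sq using comp by simp
  show "(\<integral>\<omega>. (norm (B s \<omega>))\<^sup>2 \<partial>M) = real CARD('m) * s"
    unfolding norm_sq using comp by simp
qed

text \<open>
  The integral is taken path by path, so it is a random variable only as the limit of its Riemann
  sums. By Cauchy-Schwarz their second moments are at most \<open>t\<^sup>2\<close> times the largest second moment of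
  \<open>T (B s)\<close> on \<open>[0, t]\<close>, uniformly in the mesh, and Fatou's lemma passes to the limit.
\<close>
lemma brownian_integral_square_integrable:
  fixes B :: "real \<Rightarrow> 'w \<Rightarrow> real^'m" and T :: "real^'m \<Rightarrow> 'b::euclidean_space"
  assumes bm: "standard_brownian_motion M B" and "0 \<le> t" and T: "linear T"
  shows "(\<lambda>\<omega>. integral {0..t} (\<lambda>s. T (B s \<omega>))) \<in> borel_measurable M"
    and "integrable M (\<lambda>\<omega>. (norm (integral {0..t} (\<lambda>s. T (B s \<omega>))))\<^sup>2)"
proof -
  have B_meas: "B s \<in> borel_measurable M" if "0 \<le> s" for s
    using bm that by (simp add: standard_brownian_motion_def)
  have contT: "continuous_on A T" for A
    using T by (simp add: linear_continuous_on linear_conv_bounded_linear)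
  obtain K where "0 < K" and K: "\<And>v. norm (T v) \<le> K * norm v"
    using linear_bounded_pos[OF T] by blast
  define R where "R n \<omega> = (\<Sum>k<Suc n. (t / Suc n) *\<^sub>R T (B (real k * (t / Suc n)) \<omega>))" for n \<omega>
  have T_meas[measurable]: "T \<in> borel_measurable borel"
    using contT by (rule borel_measurable_continuous_onI)
  have lim: "(\<lambda>n. R n \<omega>) \<longlonglongrightarrow> integral {0..t} (\<lambda>s. T (B s \<omega>))" if "\<omega> \<in> space M" for \<omega>
    unfolding R_def
  proof (rule left_sums_tendsto_integral[OF \<open>0 \<le> t\<close>])
    have "continuous_on {0..} (\<lambda>s. B s \<omega>)"
      using bm that by (simp add: standard_brownian_motion_def)
    then have "continuous_on {0..t} (\<lambda>s. B s \<omega>)"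
      by (rule continuous_on_subset) auto
    then show "continuous_on {0..t} (\<lambda>s. T (B s \<omega>))"
      by (rule continuous_on_compose2[OF contT[of UNIV]]) simp
  qed
  have node: "0 \<le> real k * (t / Suc n)" for k n
    using \<open>0 \<le> t\<close> by simp
  have R_meas[measurable]: "R n \<in> borel_measurable M" for n
    unfolding R_def
    by (intro borel_measurable_sum borel_measurable_scaleR borel_measurable_const
        measurable_compose[OF B_meas[OF node] T_meas])
  show "(\<lambda>\<omega>. integral {0..t} (\<lambda>s. T (B s \<omega>))) \<in> borel_measurable M"
    using lim by (rule borel_measurable_LIMSEQ_metric[rotated]) measurable
  \<comment> \<open>the Cauchy-Schwarz bound on the squared Riemann sum; its expectation is explicit\<close>
  define S where "S n \<omega> = t\<^sup>2 * K\<^sup>2 / Suc n * (\<Sum>k<Suc n. (norm (B (real k * (t / Suc n)) \<omega>))\<^sup>2)" for n \<omega>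
  have S_int: "integrable M (S n)" for n
    unfolding S_def by (intro integrable_mult_right Bochner_Integration.integrable_sum
        brownian_motion_second_moment(1)[OF bm node])
  have RS: "(norm (R n \<omega>))\<^sup>2 \<le> S n \<omega>" for n \<omega>
  proof -
    have "norm (R n \<omega>) \<le> (\<Sum>k<Suc n. t / Suc n * (K * norm (B (real k * (t / Suc n)) \<omega>)))"
      unfolding R_def
      using \<open>0 \<le> t\<close> by (intro sum_norm_le) (auto intro!: divide_right_mono mult_left_mono K)
    then have "(norm (R n \<omega>))\<^sup>2 \<le> (\<Sum>k<Suc n. t / Suc n * (K * norm (B (real k * (t / Suc n)) \<omega>)))\<^sup>2"
      by (rule power_mono) simp
    also have "\<dots> \<le> (\<Sum>k<Suc n. (t / Suc n * (K * norm (B (real k * (t / Suc n)) \<omega>)))\<^sup>2) * real (card {..<Suc n})"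
      by (rule sum_squared_le_sum_of_squares)
    also have "\<dots> = S n \<omega>"
      by (simp del: sum.lessThan_Suc of_nat_Suc add: S_def power_mult_distrib power_divide
          sum_distrib_left sum_distrib_right power2_eq_square field_simps)
    finally show ?thesis .
  qed
  have S_bound: "integral\<^sup>L M (S n) \<le> t\<^sup>2 * K\<^sup>2 * (real CARD('m) * t)" for n
  proof -
    have "integral\<^sup>L M (S n) = t\<^sup>2 * K\<^sup>2 / Suc n * (\<Sum>k<Suc n. real CARD('m) * (real k * (t / Suc n)))"
      unfolding S_def
      by (subst integral_mult_right_zero, subst Bochner_Integration.integral_sum)
        (auto simp only: brownian_motion_second_moment[OF bm node])
    also have "\<dots> \<le> t\<^sup>2 * K\<^sup>2 / Suc n * (\<Sum>k<Suc n. real CARD('m) * t)"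
    proof (intro mult_left_mono sum_mono)
      fix k assume "k \<in> {..<Suc n}"
      then have "real k * t \<le> real (Suc n) * t" using \<open>0 \<le> t\<close> by (intro mult_right_mono) auto
      then show "real k * (t / Suc n) \<le> t" by (simp add: field_simps)
    qed simp_all
    also have "\<dots> = t\<^sup>2 * K\<^sup>2 * (real CARD('m) * t)"
      by (simp del: of_nat_Suc)
    finally show ?thesis .
  qed
  show "integrable M (\<lambda>\<omega>. (norm (integral {0..t} (\<lambda>s. T (B s \<omega>))))\<^sup>2)"
  proof (rule integrable_limit_of_bounded_integrals)
    show R_int: "integrable M (\<lambda>\<omega>. (norm (R n \<omega>))\<^sup>2)" for n
      using S_int[of n] by (rule Bochner_Integration.integrable_bound)
        (auto simp: abs_of_nonneg intro: order_trans[OF RS abs_ge_self])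
    show "(\<integral>\<omega>. (norm (R n \<omega>))\<^sup>2 \<partial>M) \<le> t\<^sup>2 * K\<^sup>2 * (real CARD('m) * t)" for n
      using integral_mono[OF R_int S_int RS] S_bound by (rule order_trans)
    show "(\<lambda>n. (norm (R n \<omega>))\<^sup>2) \<longlonglongrightarrow> (norm (integral {0..t} (\<lambda>s. T (B s \<omega>))))\<^sup>2"
      if "\<omega> \<in> space M" for \<omega>
      using lim[OF that] by (intro tendsto_intros)
  qed simp
qed

lemma diffusion_square_integrable:
  fixes B :: "real \<Rightarrow> 'w \<Rightarrow> real^'m" and B\<^sub>1 :: "real^'n^'m"
  assumes bm: "standard_brownian_motion M B" and "0 \<le> t"
  shows "diffusion \<sigma> B\<^sub>1 B t 0 \<in> borel_measurable M"
    and "integrable M (\<lambda>\<omega>. (norm (diffusion \<sigma> B\<^sub>1 B t 0 \<omega>))\<^sup>2)"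
proof -
  have B_meas[measurable]: "B t \<in> borel_measurable M"
    using bm \<open>0 \<le> t\<close> by (simp add: standard_brownian_motion_def)
  have lin: "linear (\<lambda>v. transpose B\<^sub>1 *v (\<sigma> *v v))"
    by (simp add: matrix_vector_mul_assoc)
  define V where "V \<omega> = integral {0..t} (\<lambda>s. transpose B\<^sub>1 *v (\<sigma> *v B s \<omega>))" for \<omega>
  have V[measurable]: "V \<in> borel_measurable M" and V2: "integrable M (\<lambda>\<omega>. (norm (V \<omega>))\<^sup>2)"
    unfolding V_def using brownian_integral_square_integrable[OF bm \<open>0 \<le> t\<close> lin] by auto
  have X: "diffusion \<sigma> B\<^sub>1 B t 0 = (\<lambda>\<omega>. (\<sigma> *v B t \<omega>, V \<omega>))"
    by (simp add: diffusion_def V_def fun_eq_iff)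
  have "continuous_on UNIV (\<lambda>v. \<sigma> *v v)"
    by (intro linear_continuous_on linear_conv_bounded_linear[THEN iffD1]) simp
  then have \<sigma>_meas[measurable]: "(\<lambda>v. \<sigma> *v v) \<in> borel_measurable borel"
    by (rule borel_measurable_continuous_onI)
  show "diffusion \<sigma> B\<^sub>1 B t 0 \<in> borel_measurable M"
    unfolding X by simp
  obtain K where K: "\<And>v. norm (\<sigma> *v v) \<le> K * norm v"
    using linear_bounded[of "\<lambda>v. \<sigma> *v v"] by auto
  have "integrable M (\<lambda>\<omega>. (norm (\<sigma> *v B t \<omega>))\<^sup>2)"
  proof (rule Bochner_Integration.integrable_bound)
    show "integrable M (\<lambda>\<omega>. K\<^sup>2 * (norm (B t \<omega>))\<^sup>2)"
      using brownian_motion_second_moment(1)[OF bm \<open>0 \<le> t\<close>] by simp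
    show "AE \<omega> in M. norm ((norm (\<sigma> *v B t \<omega>))\<^sup>2) \<le> norm (K\<^sup>2 * (norm (B t \<omega>))\<^sup>2)"
      using power_mono[OF K, where n = 2] by (simp add: power_mult_distrib)
  qed simp
  then show "integrable M (\<lambda>\<omega>. (norm (diffusion \<sigma> B\<^sub>1 B t 0 \<omega>))\<^sup>2)"
    unfolding X using V2 by (simp add: norm_Pair)
qed

section \<open>The gradient bound\<close>

definition drift_flow :: "real^'n^'m \<Rightarrow> real \<Rightarrow> (real^'m) \<times> (real^'n) \<Rightarrow> (real^'m) \<times> (real^'n)" where
  "drift_flow B\<^sub>1 t x = (fst x, snd x + t *\<^sub>R (transpose B\<^sub>1 *v fst x))"

lemma linear_drift_flow: "linear (drift_flow B\<^sub>1 t)"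
  by (rule linearI) (simp_all add: drift_flow_def algebra_simps matrix_vector_right_distrib
      matrix_vector_mult_scaleR)

lemma diffusion_eq_drift_flow_plus:
  "diffusion \<sigma> B\<^sub>1 B t x \<omega> = drift_flow B\<^sub>1 t x + diffusion \<sigma> B\<^sub>1 B t 0 \<omega>"
  by (simp add: diffusion_def drift_flow_def)

theorem proposition2p1:
  fixes M :: "'w measure"
    and B :: "real \<Rightarrow> 'w \<Rightarrow> real^'m"
    and \<sigma> A\<^sub>0 :: "real^'m^'m"
    and B\<^sub>1 :: "real^'n^'m"
    and f :: "(real^'m) \<times> (real^'n) \<Rightarrow> real"
    and t \<alpha>\<^sub>2 :: real
    and x\<^sub>1 :: "real^'m" and x\<^sub>2 :: "real^'n"
  assumes "CARD('n) \<le> CARD('m)"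
    and "A\<^sub>0 = \<sigma> ** transpose \<sigma>"
    and "transpose A\<^sub>0 = A\<^sub>0"
    and "\<forall>v. 0 \<le> v \<bullet> (A\<^sub>0 *v v)"
    and "rank B\<^sub>1 = CARD('n)"
    and "standard_brownian_motion M B"
    and "C2_bounded_second f"
    and "0 \<le> t"
  shows "(\<forall>y. integrable M (\<lambda>\<omega>. f (diffusion \<sigma> B\<^sub>1 B t y \<omega>))) \<and>
    semigroup_P M \<sigma> B\<^sub>1 B t f differentiable (at (x\<^sub>1, x\<^sub>2)) \<and>
    integrable M (\<lambda>\<omega>. let y = diffusion \<sigma> B\<^sub>1 B t (x\<^sub>1, x\<^sub>2) \<omega> in
      (mat_norm A\<^sub>0 (grad1 f y + (\<alpha>\<^sub>2 + t) *\<^sub>R (B\<^sub>1 *v grad2 f y)))\<^sup>2) \<and>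
    (mat_norm A\<^sub>0 (grad1 (semigroup_P M \<sigma> B\<^sub>1 B t f) (x\<^sub>1, x\<^sub>2)
        + \<alpha>\<^sub>2 *\<^sub>R (B\<^sub>1 *v grad2 (semigroup_P M \<sigma> B\<^sub>1 B t f) (x\<^sub>1, x\<^sub>2))))\<^sup>2
      \<le> semigroup_P M \<sigma> B\<^sub>1 B t
          (\<lambda>y. (mat_norm A\<^sub>0 (grad1 f y + (\<alpha>\<^sub>2 + t) *\<^sub>R (B\<^sub>1 *v grad2 f y)))\<^sup>2) (x\<^sub>1, x\<^sub>2)"
proof -
  interpret prob_space M
    using \<open>standard_brownian_motion M B\<close> by (simp add: standard_brownian_motion_def)
  obtain f' C where f': "\<And>x. (f has_derivative blinfun_apply (f' x)) (at x)"
    and lip: "C-lipschitz_on UNIV f'"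
    using C2_bounded_second_lipschitz_derivative[OF \<open>C2_bounded_second f\<close>] by blast
  define x where "x = (x\<^sub>1, x\<^sub>2)"
  define X where "X = diffusion \<sigma> B\<^sub>1 B t"
  define P where "P = semigroup_P M \<sigma> B\<^sub>1 B t f"
  note X0 = diffusion_square_integrable[OF \<open>standard_brownian_motion M B\<close> \<open>0 \<le> t\<close>,
      of \<sigma> B\<^sub>1, folded X_def]
  have X_eq: "X y \<omega> = drift_flow B\<^sub>1 t y + X 0 \<omega>" for y \<omega>
    unfolding X_def by (rule diffusion_eq_drift_flow_plus)
  have X_meas: "X y \<in> borel_measurable M" for y
    unfolding X_eq[of y, THEN ext] using X0(1) by simp
  have X_sq: "integrable M (\<lambda>\<omega>. (norm (X y \<omega>))\<^sup>2)" for y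
    unfolding X_eq[of y] using X0 by (rule integrable_translate_square)
  note int = integrable_lipschitz_derivative[OF f' lip X_meas X_sq]
  have P_deriv: "(P has_derivative (\<lambda>h. expectation (\<lambda>\<omega>. f' (X x \<omega>) (drift_flow B\<^sub>1 t h)))) (at x)"
    using has_derivative_expectation_affine[OF f' lip X0 linear_drift_flow, of B\<^sub>1 t x]
    unfolding P_def semigroup_P_def[abs_def] X_def[symmetric] X_eq[symmetric] .
  \<comment> \<open>\<open>Z i\<close> pairs the twisted gradient of \<open>f\<close> along the path with the \<open>i\<close>-th column of \<open>\<sigma>\<close>\<close>
  define Z where "Z i \<omega> = f' (X x \<omega>) (column i \<sigma>, (\<alpha>\<^sub>2 + t) *\<^sub>R (transpose B\<^sub>1 *v column i \<sigma>))" for i \<omega>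
  have Z_int: "integrable M (Z i)" and Z_sq: "integrable M (\<lambda>\<omega>. (Z i \<omega>)\<^sup>2)" for i
    unfolding Z_def using int by auto
  have norm_f: "(mat_norm A\<^sub>0 (grad1 f (X x \<omega>) + (\<alpha>\<^sub>2 + t) *\<^sub>R (B\<^sub>1 *v grad2 f (X x \<omega>))))\<^sup>2
      = (\<Sum>i\<in>UNIV. (Z i \<omega>)\<^sup>2)" for \<omega>
    unfolding \<open>A\<^sub>0 = _\<close> mat_norm_square_eq_sum_columns inner_twisted_gradient[OF f'] Z_def ..
  \<comment> \<open>the flow shifts the twist from \<open>\<alpha>\<^sub>2\<close> to \<open>\<alpha>\<^sub>2 + t\<close>\<close>
  have "drift_flow B\<^sub>1 t (v, \<alpha>\<^sub>2 *\<^sub>R (transpose B\<^sub>1 *v v)) = (v, (\<alpha>\<^sub>2 + t) *\<^sub>R (transpose B\<^sub>1 *v v))" for v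
    by (simp add: drift_flow_def scaleR_add_left)
  then have norm_P: "(mat_norm A\<^sub>0 (grad1 P x + \<alpha>\<^sub>2 *\<^sub>R (B\<^sub>1 *v grad2 P x)))\<^sup>2
      = (\<Sum>i\<in>UNIV. (expectation (Z i))\<^sup>2)"
    unfolding \<open>A\<^sub>0 = _\<close> mat_norm_square_eq_sum_columns inner_twisted_gradient[OF P_deriv] Z_def
    by simp
  have "(\<Sum>i\<in>UNIV. (expectation (Z i))\<^sup>2) \<le> (\<Sum>i\<in>UNIV. expectation (\<lambda>\<omega>. (Z i \<omega>)\<^sup>2))"
    by (intro sum_mono expectation_square_le Z_int Z_sq)
  also have "\<dots> = expectation (\<lambda>\<omega>. \<Sum>i\<in>UNIV. (Z i \<omega>)\<^sup>2)"
    by (simp add: Z_sq)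
  finally have "(mat_norm A\<^sub>0 (grad1 P x + \<alpha>\<^sub>2 *\<^sub>R (B\<^sub>1 *v grad2 P x)))\<^sup>2
      \<le> semigroup_P M \<sigma> B\<^sub>1 B t
          (\<lambda>y. (mat_norm A\<^sub>0 (grad1 f y + (\<alpha>\<^sub>2 + t) *\<^sub>R (B\<^sub>1 *v grad2 f y)))\<^sup>2) x"
    unfolding norm_P semigroup_P_def X_def[symmetric] norm_f .
  moreover have "P differentiable (at x)"
    using P_deriv unfolding differentiable_def by blast
  moreover have "integrable M (\<lambda>\<omega>. let y = X x \<omega> in
      (mat_norm A\<^sub>0 (grad1 f y + (\<alpha>\<^sub>2 + t) *\<^sub>R (B\<^sub>1 *v grad2 f y)))\<^sup>2)"
    unfolding Let_def norm_f using Z_sq by simp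
  ultimately show ?thesis
    using int(1) unfolding P_def X_def x_def by blast
qed

end
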